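(* $$\sum_{r=1}^\infty \frac{h_{r,2}^2}{4r^2-1}=\frac{3\pi^2}{64}\,\zeta(3) .$$
   Context: For a positive integer $N$, $h_{N,m}=\sum_{r=1}^N \frac{1}{(2r-1)^m}$ is the generalized associated harmonic number of order $m$; $h_{r,2}^2$ denotes $(h_{r,2})^2$. $\zeta(m)=\sum_{r=1}^\infty r^{-m}$ is the Riemann zeta function. *)

theory Defs
  imports "HOL-Analysis.Analysis"
begin

definition assoc_harm :: "nat \<Rightarrow> nat \<Rightarrow> real" where
  "assoc_harm N m = (\<Sum>r=1..N. 1 / (2 * real r - 1) ^ m)"

(* Riemann zeta at integer arguments. The series starts at index 0, hence the shift by Suc.
   Only m >= 2 is meaningful: the series diverges for m < 2. *)
definition zeta :: "nat \<Rightarrow> real" where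
  "zeta m = (\<Sum>r. 1 / real (Suc r) ^ m)"

end

(* For n >= 1 and odd a > 0 put f(n,a) = (1/(2n-a)^2 - 1/(2n+a)^2) / a^3 >= 0. For fixed n, partial
   fractions in a reduce the sum over a to multiples of the sums of 1/a^2, of 1/(2n-a)^2 + 1/(2n+a)^2
   and of 1/(2n-a) + 1/(2n+a); the last two run over all odd integers, so they do not depend on n,
   and f(n,_) sums to 3 pi^2 / (32 n^3). For fixed a = 2r-1, the sum over n telescopes to
   (h_r + h_{r-1}) / a^3 with h_r = h_{r,2}. Exchanging the sums evaluates the series of
   (h_r + h_{r-1}) / (2r-1)^3 = (h_r^2 - h_{r-1}^2) / (2r-1), from which Abel summation with
   2/(4r^2-1) = 1/(2r-1) - 1/(2r+1) gives the claim. *)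
theory Submission
  imports Defs "HOL-Real_Asymp.Real_Asymp"
begin

text \<open>Grouping the Basel series in consecutive pairs splits off the even terms, which are a
  quarter of the whole: pi^2/6 - pi^2/24 = pi^2/8.\<close>

lemma odd_inverse_squares_sums: "(\<lambda>k. 1 / (2 * real k + 1)\<^sup>2) sums (pi\<^sup>2 / 8)"
proof -
  have all: "(\<lambda>n. 1 / (real n + 1)\<^sup>2) sums (pi\<^sup>2 / 6)"
    using inverse_squares_sums by (simp add: add.commute)
  have "(\<lambda>n. \<Sum>m\<in>{n * 2..<n * 2 + 2}. 1 / (real m + 1)\<^sup>2) sums (pi\<^sup>2 / 6)"
    by (rule sums_group[OF all]) simp
  moreover have "(\<Sum>m\<in>{n * 2..<n * 2 + 2}. 1 / (real m + 1)\<^sup>2) =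
      1 / (2 * real n + 1)\<^sup>2 + 1 / 4 * (1 / (real n + 1)\<^sup>2)" for n
  proof -
    have "{n * 2..<n * 2 + 2} = {2 * n, 2 * n + 1}" by auto
    moreover have "(2 + 2 * real n)\<^sup>2 = 4 * (real n + 1)\<^sup>2" by algebra
    ultimately show ?thesis by simp
  qed
  ultimately have "(\<lambda>n. 1 / (2 * real n + 1)\<^sup>2 + 1 / 4 * (1 / (real n + 1)\<^sup>2)) sums (pi\<^sup>2 / 6)"
    by simp
  from sums_diff[OF this sums_mult[OF all, of "1 / 4"]]
  show ?thesis by simp
qed

text \<open>Both sides run over all odd integers, paired symmetrically about 2n. Moving the centre
  to 2n + 2 changes the left and the right half by telescoping series of sums
  \<open>\<phi> (2 * real n + 1)\<close> and its negative, so the value stays that of centre 0.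
  Keeping the terms paired allows \<open>\<phi>\<close> = 1/x, whose halves diverge
  separately.\<close>

lemma two_sided_odd_shift_sums:
  fixes \<phi> :: "real \<Rightarrow> real"
  assumes top: "(\<phi> \<longlongrightarrow> 0) at_top" and bot: "(\<phi> \<longlongrightarrow> 0) at_bot"
    and base: "(\<lambda>k. \<phi> (- (2 * real k + 1)) + \<phi> (2 * real k + 1)) sums L"
  shows "(\<lambda>k. \<phi> (2 * real n - (2 * real k + 1)) + \<phi> (2 * real n + (2 * real k + 1))) sums L"
proof (induction n)
  case 0
  then show ?case using base by (simp add: algebra_simps)
next
  case (Suc n)
  have "(\<lambda>k. \<phi> (2 * real n + 1 - 2 * real k)) \<longlonglongrightarrow> 0"
  proof (rule filterlim_compose[OF bot])
    show "filterlim (\<lambda>k. 2 * real n + 1 - 2 * real k) at_bot sequentially"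
      by real_asymp
  qed
  from telescope_sums'[OF this]
  have 1: "(\<lambda>k. \<phi> (2 * real n + 1 - 2 * real k) - \<phi> (2 * real n - (2 * real k + 1)))
      sums \<phi> (2 * real n + 1)"
    by (simp add: algebra_simps)
  have "(\<lambda>k. \<phi> (2 * real n + (2 * real k + 1))) \<longlonglongrightarrow> 0"
  proof (rule filterlim_compose[OF top])
    show "filterlim (\<lambda>k. 2 * real n + (2 * real k + 1)) at_top sequentially"
      by real_asymp
  qed
  from telescope_sums[OF this]
  have 2: "(\<lambda>k. \<phi> (2 * real n + (2 * real k + 3)) - \<phi> (2 * real n + (2 * real k + 1)))
      sums (- \<phi> (2 * real n + 1))"
    by (simp add: algebra_simps)
  from sums_add[OF sums_add[OF 1 2] Suc]
  show ?case by (simp add: algebra_simps)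
qed

lemma even_diff_odd_nonzero: "2 * real n - (2 * real k + 1) \<noteq> 0"
proof
  assume "2 * real n - (2 * real k + 1) = 0"
  then have "real (2 * n) = real (2 * k + 1)" by simp
  then have "2 * n = 2 * k + 1" by (simp only: of_nat_eq_iff)
  then show False by presburger
qed

lemma odd_row_sums:
  assumes "n > 0"
  shows "(\<lambda>k. (1 / (2 * real n - (2 * real k + 1))\<^sup>2 - 1 / (2 * real n + (2 * real k + 1))\<^sup>2)
      / (2 * real k + 1) ^ 3) sums (3 * pi\<^sup>2 / 32 * (1 / real n ^ 3))"
proof -
  define N where "N = 2 * real n"
  have N: "N > 0" using assms by (simp add: N_def)
  \<comment> \<open>At centre 0 each pair cancels because 1/x is odd.\<close>
  have lin: "(\<lambda>k. 1 / (N - (2 * real k + 1)) + 1 / (N + (2 * real k + 1))) sums 0"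
    unfolding N_def
  proof (rule two_sided_odd_shift_sums[where \<phi> = "\<lambda>x. 1 / x"])
    show "((\<lambda>x. 1 / x) \<longlongrightarrow> (0::real)) at_top" by real_asymp
    show "((\<lambda>x. 1 / x) \<longlongrightarrow> (0::real)) at_bot" by real_asymp
    have "1 / - (2 * real k + 1) + 1 / (2 * real k + 1) = 0" for k
      by (simp only: minus_divide_right[symmetric])
    then show "(\<lambda>k. 1 / - (2 * real k + 1) + 1 / (2 * real k + 1)) sums 0" by simp
  qed
  have quad: "(\<lambda>k. 1 / (N - (2 * real k + 1))\<^sup>2 + 1 / (N + (2 * real k + 1))\<^sup>2) sums (pi\<^sup>2 / 4)"
    unfolding N_def
  proof (rule two_sided_odd_shift_sums[where \<phi> = "\<lambda>x. 1 / x\<^sup>2"])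
    show "((\<lambda>x. 1 / x\<^sup>2) \<longlongrightarrow> (0::real)) at_top" by real_asymp
    show "((\<lambda>x. 1 / x\<^sup>2) \<longlongrightarrow> (0::real)) at_bot" by real_asymp
    show "(\<lambda>k. 1 / (- (2 * real k + 1))\<^sup>2 + 1 / (2 * real k + 1)\<^sup>2) sums (pi\<^sup>2 / 4)"
      unfolding power2_minus using sums_add[OF odd_inverse_squares_sums odd_inverse_squares_sums] by simp
  qed
  \<comment> \<open>The left side is even in a, which rules out a 1/a term; 4/N^3 comes from the
    linear term 4a/N^3 of the numerator at 0. Near a = N, 1/a^3 = 1/N^3 + 3(N - a)/N^4 + ... gives
    the other coefficients, and evenness carries them over to a = -N.\<close>
  have pf: "(1 / (N - a)\<^sup>2 - 1 / (N + a)\<^sup>2) / a ^ 3 =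
      4 / N ^ 3 * (1 / a\<^sup>2) + (1 / N ^ 3 * (1 / (N - a)\<^sup>2 + 1 / (N + a)\<^sup>2)
       + 3 / N ^ 4 * (1 / (N - a) + 1 / (N + a)))"
    if "a > 0" "N - a \<noteq> 0" for a
  proof -
    have "N + a \<noteq> 0" using that N by simp
    then show ?thesis using that N
      by (simp add: divide_simps) (simp add: eval_nat_numeral algebra_simps)
  qed
  have nz: "N - (2 * real k + 1) \<noteq> 0" for k
    unfolding N_def by (rule even_diff_odd_nonzero)
  have "(\<lambda>k. (1 / (N - (2 * real k + 1))\<^sup>2 - 1 / (N + (2 * real k + 1))\<^sup>2) / (2 * real k + 1) ^ 3)
      sums (4 / N ^ 3 * (pi\<^sup>2 / 8) + (1 / N ^ 3 * (pi\<^sup>2 / 4) + 3 / N ^ 4 * 0))"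
    unfolding pf[OF _ nz, OF add_nonneg_pos[OF mult_nonneg_nonneg[OF zero_le_numeral of_nat_0_le_iff] zero_less_one]]
    by (intro sums_add sums_mult odd_inverse_squares_sums quad lin)
  also have "4 / N ^ 3 * (pi\<^sup>2 / 8) + (1 / N ^ 3 * (pi\<^sup>2 / 4) + 3 / N ^ 4 * 0)
      = 3 * pi\<^sup>2 / 32 * (1 / real n ^ 3)"
    using assms by (simp add: N_def power_mult_distrib field_simps)
  finally show ?thesis unfolding N_def .
qed

lemma assoc_harm_Suc: "assoc_harm (Suc n) m = assoc_harm n m + 1 / (2 * real n + 1) ^ m"
  by (simp add: assoc_harm_def algebra_simps)

text \<open>Induction on k: replacing a = 2k+1 by a + 2 moves the first fraction one index back and
  the second one index forward. The two changes telescope to 1/(2k+1)^2 and 1/(2k+3)^2, exactly the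
  increments of the two harmonic numbers.\<close>

lemma odd_column_sums:
  "(\<lambda>n. 1 / (2 * real (Suc n) - (2 * real k + 1))\<^sup>2 - 1 / (2 * real (Suc n) + (2 * real k + 1))\<^sup>2)
    sums (assoc_harm (Suc k) 2 + assoc_harm k 2)"
proof (induction k)
  case 0
  have "(\<lambda>n. 1 / (2 * real n + 1)\<^sup>2) \<longlonglongrightarrow> 0" by real_asymp
  from telescope_sums'[OF this] show ?case
    by (simp add: assoc_harm_def algebra_simps)
next
  case (Suc k)
  have "(\<lambda>n. 1 / (2 * real n - (2 * real k + 1))\<^sup>2) \<longlonglongrightarrow> 0" by real_asymp
  from telescope_sums'[OF this]
  \<comment> \<open>The boundary term is that of n = 0, where squaring removes the sign of
    -(2k+1).\<close>
  have 1: "(\<lambda>n. 1 / (2 * real n - (2 * real k + 1))\<^sup>2 - 1 / (2 * real (Suc n) - (2 * real k + 1))\<^sup>2)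
      sums (1 / (2 * real k + 1)\<^sup>2)"
    by (simp only: of_nat_0 mult_zero_right diff_0 diff_0_right power2_minus)
  have "(\<lambda>n. 1 / (2 * real (Suc n) + (2 * real k + 1))\<^sup>2) \<longlonglongrightarrow> 0" by real_asymp
  from telescope_sums'[OF this]
  have 2: "(\<lambda>n. 1 / (2 * real (Suc n) + (2 * real k + 1))\<^sup>2 - 1 / (2 * real (Suc (Suc n)) + (2 * real k + 1))\<^sup>2)
      sums (1 / (2 * real (Suc k) + 1)\<^sup>2)"
    by (simp add: algebra_simps)
  have shift: "2 * real (Suc n) - (2 * real (Suc k) + 1) = 2 * real n - (2 * real k + 1)"
    "2 * real (Suc n) + (2 * real (Suc k) + 1) = 2 * real (Suc (Suc n)) + (2 * real k + 1)" for n
    by simp_all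
  from sums_add[OF sums_add[OF 1 2] Suc]
  show ?case unfolding shift assoc_harm_Suc[of "Suc k"] assoc_harm_Suc[of k]
    by (simp add: algebra_simps)
qed

text \<open>Tonelli's theorem for series: nonnegativity turns each \<open>sums\<close> into an
  unconditional \<open>has_sum\<close>, and convergence of the row totals makes the double family
  summable, so it may be summed by columns as well.\<close>

lemma sums_swap_nonneg:
  fixes f :: "nat \<Rightarrow> nat \<Rightarrow> real"
  assumes nonneg: "\<And>n k. f n k \<ge> 0"
    and row: "\<And>n. f n sums r n" and col: "\<And>k. (\<lambda>n. f n k) sums c k" and tot: "r sums T"
  shows "c sums T"
proof -
  have row': "(f n has_sum r n) UNIV" for n
    using sums_nonneg_imp_has_sum[OF row nonneg] .
  have col': "((\<lambda>n. f n k) has_sum c k) UNIV" for k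
    using sums_nonneg_imp_has_sum[OF col nonneg] .
  have "r n \<ge> 0" for n
    using sums_le[OF nonneg sums_zero row] .
  then have tot': "(r has_sum T) UNIV"
    using sums_nonneg_imp_has_sum tot by blast
  have "(\<lambda>(n, k). f n k) summable_on UNIV \<times> UNIV"
  proof (rule summable_on_SigmaI[where g = r])
    show "r summable_on UNIV" using tot' by (rule has_sum_imp_summable)
  qed (use row' nonneg in auto)
  then have "((\<lambda>(n, k). f n k) has_sum T) (UNIV \<times> UNIV)"
    by (intro has_sum_SigmaI[OF _ tot']) (use row' in auto)
  then have "((\<lambda>(k, n). f n k) has_sum T) (UNIV \<times> UNIV)"
    by (subst has_sum_swap) simp
  then have "(c has_sum T) UNIV"
    by (rule has_sum_SigmaD) (use col' in auto)
  then show ?thesis by (rule has_sum_imp_sums)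
qed

lemma assoc_harm_cubic_sums:
  "(\<lambda>k. (assoc_harm (Suc k) 2 + assoc_harm k 2) / (2 * real k + 1) ^ 3)
    sums (3 * pi\<^sup>2 / 32 * zeta 3)"
proof (rule sums_swap_nonneg)
  fix n k :: nat
  have "\<bar>2 * real (Suc n) - (2 * real k + 1)\<bar> \<le> \<bar>2 * real (Suc n) + (2 * real k + 1)\<bar>" by auto
  then have le: "(2 * real (Suc n) - (2 * real k + 1))\<^sup>2 \<le> (2 * real (Suc n) + (2 * real k + 1))\<^sup>2"
    by (simp only: abs_le_square_iff)
  \<comment> \<open>Parity matters here: at a zero denominator the convention 1/0 = 0 would reverse
    the next inequality.\<close>
  have "0 < (2 * real (Suc n) - (2 * real k + 1))\<^sup>2" 
    by (simp only: zero_less_power2 even_diff_odd_nonzero not_False_eq_True)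
  then have "1 / (2 * real (Suc n) + (2 * real k + 1))\<^sup>2 \<le> 1 / (2 * real (Suc n) - (2 * real k + 1))\<^sup>2"
    using le by (intro divide_left_mono mult_pos_pos) auto
  then show "0 \<le> (1 / (2 * real (Suc n) - (2 * real k + 1))\<^sup>2 - 1 / (2 * real (Suc n) + (2 * real k + 1))\<^sup>2)
      / (2 * real k + 1) ^ 3"
    by (intro divide_nonneg_nonneg) auto
next
  fix n :: nat
  show "(\<lambda>k. (1 / (2 * real (Suc n) - (2 * real k + 1))\<^sup>2 - 1 / (2 * real (Suc n) + (2 * real k + 1))\<^sup>2)
      / (2 * real k + 1) ^ 3) sums (3 * pi\<^sup>2 / 32 * (1 / real (Suc n) ^ 3))"
    by (rule odd_row_sums) simp
next
  fix k :: nat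
  show "(\<lambda>n. (1 / (2 * real (Suc n) - (2 * real k + 1))\<^sup>2 - 1 / (2 * real (Suc n) + (2 * real k + 1))\<^sup>2)
      / (2 * real k + 1) ^ 3) sums ((assoc_harm (Suc k) 2 + assoc_harm k 2) / (2 * real k + 1) ^ 3)"
    by (rule sums_divide[OF odd_column_sums])
next
  have "summable (\<lambda>n. 1 / real (Suc n) ^ 3)"
    using inverse_power_summable[of 3, where 'a = real]
    by (subst summable_Suc_iff) (simp add: inverse_eq_divide)
  then show "(\<lambda>n. 3 * pi\<^sup>2 / 32 * (1 / real (Suc n) ^ 3)) sums (3 * pi\<^sup>2 / 32 * zeta 3)"
    unfolding zeta_def by (intro sums_mult summable_sums)
qed

theorem mainTheorem6:
  shows "(\<lambda>n. let r = Suc n in (assoc_harm r 2)\<^sup>2 / (4 * (real r)\<^sup>2 - 1))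
           sums (3 * pi\<^sup>2 / 64 * zeta 3)"
proof -
  have "(\<lambda>n. assoc_harm n 2) = (\<lambda>n. \<Sum>k<n. 1 / (2 * real k + 1)\<^sup>2)"
  proof
    show "assoc_harm n 2 = (\<Sum>k<n. 1 / (2 * real k + 1)\<^sup>2)" for n
      by (induction n) (simp_all add: assoc_harm_Suc, simp add: assoc_harm_def)
  qed
  then have lim: "(\<lambda>n. assoc_harm n 2) \<longlonglongrightarrow> pi\<^sup>2 / 8"
    using odd_inverse_squares_sums by (simp add: sums_def)
  have "(\<lambda>n. 1 / (2 * real n + 1)) \<longlonglongrightarrow> 0" by real_asymp
  from tendsto_mult[OF tendsto_power[OF lim, of 2] this]
  have "(\<lambda>n. (assoc_harm n 2)\<^sup>2 / (2 * real n + 1)) \<longlonglongrightarrow> 0" by simp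
  from telescope_sums'[OF this]
  \<comment> \<open>The sum is the first term of the null sequence, which is 0 because
    \<open>assoc_harm 0 2\<close> is an empty sum.\<close>
  have tele: "(\<lambda>n. (assoc_harm n 2)\<^sup>2 / (2 * real n + 1) - (assoc_harm (Suc n) 2)\<^sup>2 / (2 * real (Suc n) + 1))
      sums 0"
    by (simp add: assoc_harm_def)
  \<comment> \<open>Abel summation term by term: with a = 2n+1, split 2/(a(a+2)) = 1/a - 1/(a+2),
    then add and subtract h_n^2/a. The difference h_{n+1}^2 - h_n^2 factors as (h_{n+1} + h_n)/a^2,
    which produces the cubic denominator.\<close>
  have parts: "(let r = Suc n in (assoc_harm r 2)\<^sup>2 / (4 * (real r)\<^sup>2 - 1)) =
      1 / 2 * ((assoc_harm (Suc n) 2 + assoc_harm n 2) / (2 * real n + 1) ^ 3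
       + ((assoc_harm n 2)\<^sup>2 / (2 * real n + 1) - (assoc_harm (Suc n) 2)\<^sup>2 / (2 * real (Suc n) + 1)))" for n
  proof -
    define a where "a = 2 * real n + 1"
    have a: "a > 0" "2 * real (Suc n) + 1 = a + 2" by (simp_all add: a_def)
    have *: "4 * (real (Suc n))\<^sup>2 - 1 = a * (a + 2)"
      by (simp add: a_def power2_eq_square algebra_simps)
    have "assoc_harm (Suc n) 2 = assoc_harm n 2 + 1 / a\<^sup>2"
      by (simp add: assoc_harm_Suc a_def)
    then have h: "assoc_harm n 2 = assoc_harm (Suc n) 2 - 1 / a\<^sup>2" by simp
    show ?thesis
      unfolding Let_def * a(2) unfolding h a_def[symmetric]
      using a(1) by (simp add: divide_simps) algebra
  qed
  from sums_mult[OF sums_add[OF assoc_harm_cubic_sums tele], of "1 / 2"]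
  show ?thesis unfolding parts by simp
qed

end
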